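(* Consider the two-model self-consuming training loop described in the context. Suppose that $\ell_\theta$ is $\gamma_\theta$-strongly convex in $\theta$ and $\ell_\phi$ is $\gamma_\phi$-strongly convex in $\phi$; that $\ell_\theta$ is $L_\theta$-smooth in $(x,y)$ and $\theta$ and $\ell_\phi$ is $L_\phi$-smooth in $(x,y)$ and $\phi$; that $\mathcal X,\mathcal Y$ are bounded; that both models are Lipschitz in their inputs and parameters and the reward functions are Lipschitz in their inputs; and that $P(\theta,\phi)$ and $Q(\theta,\phi)$ are $\varepsilon_\theta$- and $\varepsilon_\phi$-sensitive. Let $\tau\in(0,1)$ be a threshold such that, whenever $\min(\lambda_{\mathcal R}^\theta,\lambda_{\mathcal R}^\phi)>\tau$, a unique stable point exists and the training loop converges to it. Then for any real-data weights $\widehat\lambda_{\mathcal R}^\theta,\widehat\lambda_{\mathcal R}^\phi>\tau$, $$\Big|J_p\big(\theta^*(\widehat\lambda_{\mathcal R}^\theta)\big)-J_p\big(\theta^*(1)\big)\Big|=\mathcal O\big(1-\widehat\lambda_{\mathcal R}^\theta\big),\qquad \Big|J_q\big(\phi^*(\widehat\lambda_{\mathcal R}^\phi)\big)-J_q\big(\phi^*(1)\big)\Big|=\mathcal O\big(1-\widehat\lambda_{\mathcal R}^\phi\big).$$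
   Context: Setting. $\Theta,\Phi$ are closed convex subsets of Euclidean spaces, $\mathcal X,\mathcal Y$ are subsets of Euclidean spaces. Model $\theta$ takes input $y\in\mathcal Y$ and outputs $x\sim p_\theta(x|y)$; model $\phi$ takes input $x\in\mathcal X$ and outputs $y\sim q_\phi(y|x)$. Losses $\ell_\theta(x,y)$, $\ell_\phi(x,y)$; rewards $r_\theta(x,y)$, $r_\phi(x,y)$. Lipschitz models: outputs are written $x=p(y,\theta)$, $y=q(x,\phi)$ (possibly also depending on independent internal randomness $\xi$) and for each realization of $\xi$ are $L$-Lipschitz: $\|p(y,\theta)-p(y',\theta')\|\le L(\|y-y'\|+\|\theta-\theta'\|)$, $\|q(x,\phi)-q(x',\phi')\|\le L(\|x-x'\|+\|\phi-\phi'\|)$. Training distributions. $P_t$, $Q_t$ are the training-data distributions on $\mathcal X\times\mathcal Y$ of models $\theta$, $\phi$ at round $t$, with marginals $P_t^y$, $Q_t^x$. Model $\theta$ generates pairs $(x',y')$ with $y'\sim P_t^y$, $x'\sim p_\theta(x|y')$; model $\phi$ generates pairs with $x'\sim Q_t^x$, $y'\sim q_\phi(y|x')$. The synthetic data of $\theta$ has fraction $1-\lambda_\theta^\phi$ generated by $\theta$ and $\lambda_\theta^\phi$ by $\phi$; that of $\phi$ has fraction $1-\lambda_\phi^\theta$ generated by $\phi$ and $\lambda_\phi^\theta$ by $\theta$. Curated data has the same fractions, but for each input $i$ the generating model draws $K$ i.i.d. outputs $o_1,\dots,o_K$ and one is selected with probability $e^{r(i,o_s)}/\sum_k e^{r(i,o_k)}$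 ($r$ the reward of the generating model). $P_{t+1}$ is the mixture of the fixed real data distribution, synthetic and curated distributions of $\theta$ with nonnegative weights $\lambda_{\mathcal R}^\theta+\lambda_{\mathcal S}^\theta+\lambda_{\mathcal H}^\theta=1$; similarly $Q_{t+1}$ for $\phi$ with $\lambda_{\mathcal R}^\phi+\lambda_{\mathcal S}^\phi+\lambda_{\mathcal H}^\phi=1$. The distributions built with model parameters $(\theta,\phi)$ are denoted $P(\theta,\phi)$, $Q(\theta,\phi)$. Updates: $\theta_{t+1}=\arg\min_\theta\mathbb E_{P_{t+1}}[\ell_\theta]$, $\phi_{t+1}=\arg\min_\phi\mathbb E_{Q_{t+1}}[\ell_\phi]$, synchronously ($P_{t+1}=P(\theta_t,\phi_t)$, $Q_{t+1}=Q(\theta_t,\phi_t)$) or asynchronously (e.g. $P_{t+1}=P(\theta_t,\phi_t)$, $Q_{t+1}=Q(\theta_{t+1},\phi_t)$, or the reverse order). Stable point: $\theta^*=\arg\min_\theta\mathbb E_{P(\theta^*,\phi^* )}[\ell_\theta]$, $\phi^*=\arg\min_\phi\mathbb E_{Q(\theta^*,\phi^* )}[\ell_\phi]$, where $P(\theta^*,\phi^* ),Q(\theta^*,\phi^* )$ are the training distributions that no longer change when the models are held at $(\theta^*,\phi^* )$. $\theta^*(\lambda_{\mathcal R}^\theta)$, $\phi^*(\lambda_{\mathcal R}^\phi)$ denote the components of the stable point of the system with real-data weights $\lambda_{\mathcal R}^\theta,\lambda_{\mathcal R}^\phi$; $\theta^*(1),\phi^*(1)$ correspond to purely real training data, $\lambda_{\mathcal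 R}^\theta=\lambda_{\mathcal R}^\phi=1$. The constants in $\mathcal O(\cdot)$ do not depend on the weights. Alignment: $J_p(\theta)=\mathbb E_{y\sim\mathcal E_\theta,\,x\sim p_\theta(x|y)}[r_\theta(x,y)]$, $J_q(\phi)=\mathbb E_{x\sim\mathcal E_\phi,\,y\sim q_\phi(y|x)}[r_\phi(x,y)]$ with fixed evaluation distributions $\mathcal E_\theta,\mathcal E_\phi$. Strong convexity: $\ell_\theta(\theta)\ge\ell_\theta(\theta')+\nabla_\theta\ell_\theta(\theta')^T(\theta-\theta')+\frac{\gamma_\theta}{2}\|\theta-\theta'\|^2$, $\gamma_\theta>0$ (similarly $\phi$). Smoothness: $\|\nabla_\theta\ell_\theta(x,y)-\nabla_\theta\ell_\theta(x',y')\|\le L_\theta\|(x,y)-(x',y')\|$ and $\|\nabla_\theta\ell_\theta(\theta)-\nabla_\theta\ell_\theta(\theta')\|\le L_\theta\|\theta-\theta'\|$ (similarly $\phi$). Sensitivity: $W(P(\theta,\phi),P(\theta',\phi'))\le\varepsilon_\theta\|(\theta,\phi)-(\theta',\phi')\|$ and $W(Q(\theta,\phi),Q(\theta',\phi'))\le\varepsilon_\phi\|(\theta,\phi)-(\theta',\phi')\|$, $W$ the Wasserstein-1 distance. *)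

theory Defs
  imports "HOL-Probability.Probability"
begin

text \<open>Distributions live on the Borel sigma-algebra of the ambient Euclidean space and are
  concentrated on the given set, which need not be Borel.\<close>

definition dist_on :: "'a::topological_space set \<Rightarrow> 'a measure \<Rightarrow> bool" where
  "dist_on A \<mu> \<longleftrightarrow> prob_space \<mu> \<and> sets \<mu> = sets borel \<and> (AE z in \<mu>. z \<in> A)"

definition mixture :: "(real \<times> 'a::topological_space measure) list \<Rightarrow> 'a measure" where
  "mixture cs = measure_of UNIV (sets borel) (\<lambda>A. \<Sum>(c, \<mu>)\<leftarrow>cs. ennreal c * emeasure \<mu> A)"

definition couplings :: "'a::euclidean_space measure \<Rightarrow> 'a measure \<Rightarrow> ('a \<times> 'a) measure set" where
  "couplings \<mu> \<nu> = {\<pi>. prob_space \<pi> \<and> sets \<pi> = sets borel \<and>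
     distr \<pi> borel fst = \<mu> \<and> distr \<pi> borel snd = \<nu>}"

definition wasserstein1 :: "'a::euclidean_space measure \<Rightarrow> 'a measure \<Rightarrow> ennreal" where
  "wasserstein1 \<mu> \<nu> = (INF \<pi>\<in>couplings \<mu> \<nu>. \<integral>\<^sup>+ (z, z'). ennreal (dist z z') \<partial>\<pi>)"

text \<open>A model is a map from input, parameter and an independent noise realization to the output;
  its conditional law given the input is the push-forward of the noise distribution.
  A deterministic model is one that ignores the noise.\<close>

definition cond_law :: "'n measure \<Rightarrow> ('i \<Rightarrow> 'par \<Rightarrow> 'n \<Rightarrow> 'o::topological_space) \<Rightarrow> 'par \<Rightarrow> 'i \<Rightarrow> 'o measure" where
  "cond_law N f \<theta> i = distr N borel (f i \<theta>)"

definition softmax_choice :: "nat \<Rightarrow> (nat \<Rightarrow> real) \<Rightarrow> nat measure" where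
  "softmax_choice K v = point_measure {..<K} (\<lambda>s. ennreal (exp (v s) / (\<Sum>k<K. exp (v k))))"

text \<open>Law of the output selected among \<open>K\<close> i.i.d. draws from \<open>\<nu>\<close>, where \<open>r\<close> is the reward of an output.\<close>

definition curated_law :: "nat \<Rightarrow> ('o \<Rightarrow> real) \<Rightarrow> 'o::topological_space measure \<Rightarrow> 'o measure" where
  "curated_law K r \<nu> =
     PiM {..<K} (\<lambda>_. \<nu>) \<bind> (\<lambda>os. distr (softmax_choice K (\<lambda>s. r (os s))) borel (\<lambda>s. os s))"

text \<open>Joint law of \<open>pr i o\<close> where the input \<open>i\<close> has law \<open>\<mu>\<close> and, given \<open>i\<close>, the output \<open>o\<close> has law \<open>\<kappa> i\<close>.\<close>

definition joint_law :: "('i \<Rightarrow> 'o \<Rightarrow> 'z::topological_space) \<Rightarrow> 'i measure \<Rightarrow> ('i \<Rightarrow> 'o measure) \<Rightarrow> 'z measure" where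
  "joint_law pr \<mu> \<kappa> = \<mu> \<bind> (\<lambda>i. distr (\<kappa> i) borel (pr i))"

text \<open>Data pairs are always ordered \<open>(x, y)\<close>. Model \<open>\<theta>\<close> maps \<open>y\<close> to \<open>x\<close>, model \<open>\<phi>\<close> maps \<open>x\<close> to \<open>y\<close>.
  The suffix \<open>_th\<close> refers to model \<open>\<theta>\<close>, the suffix \<open>_ph\<close> to model \<open>\<phi>\<close>.\<close>

record ('th, 'ph, 'x, 'y, 'u, 'v) two_model_system =
  par_th :: "'th set"
  par_ph :: "'ph set"
  dom_x :: "'x set"
  dom_y :: "'y set"
  noise_th :: "'u measure"
  noise_ph :: "'v measure"
  out_th :: "'y \<Rightarrow> 'th \<Rightarrow> 'u \<Rightarrow> 'x"
  out_ph :: "'x \<Rightarrow> 'ph \<Rightarrow> 'v \<Rightarrow> 'y"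
  reward_th :: "'x \<times> 'y \<Rightarrow> real"
  reward_ph :: "'x \<times> 'y \<Rightarrow> real"
  loss_th :: "'th \<Rightarrow> 'x \<times> 'y \<Rightarrow> real"
  loss_ph :: "'ph \<Rightarrow> 'x \<times> 'y \<Rightarrow> real"
  real_th :: "('x \<times> 'y) measure"
  real_ph :: "('x \<times> 'y) measure"
  eval_th :: "'y measure"
  eval_ph :: "'x measure"
  draws :: nat

definition dom_xy :: "('th, 'ph, 'x, 'y, 'u, 'v) two_model_system \<Rightarrow> ('x \<times> 'y) set" where
  "dom_xy S = dom_x S \<times> dom_y S"

text \<open>Standing assumptions. The model maps and rewards only matter on the data domain, but are taken
  to be Borel measurable on the whole space. The integrability conditions say that the
  expected losses are well defined.\<close>

definition well_formed ::
  "('th::euclidean_space, 'ph::euclidean_space, 'x::euclidean_space, 'y::euclidean_space, 'u, 'v) two_model_system \<Rightarrow> bool"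
where
  "well_formed S \<longleftrightarrow>
     closed (par_th S) \<and> convex (par_th S) \<and> closed (par_ph S) \<and> convex (par_ph S) \<and>
     prob_space (noise_th S) \<and> prob_space (noise_ph S) \<and>
     (\<forall>\<theta>\<in>par_th S. (\<lambda>(y, \<xi>). out_th S y \<theta> \<xi>) \<in> borel \<Otimes>\<^sub>M noise_th S \<rightarrow>\<^sub>M borel) \<and>
     (\<forall>\<phi>\<in>par_ph S. (\<lambda>(x, \<xi>). out_ph S x \<phi> \<xi>) \<in> borel \<Otimes>\<^sub>M noise_ph S \<rightarrow>\<^sub>M borel) \<and>
     (\<forall>y\<in>dom_y S. \<forall>\<theta>\<in>par_th S. \<forall>\<xi>\<in>space (noise_th S). out_th S y \<theta> \<xi> \<in> dom_x S) \<and>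
     (\<forall>x\<in>dom_x S. \<forall>\<phi>\<in>par_ph S. \<forall>\<xi>\<in>space (noise_ph S). out_ph S x \<phi> \<xi> \<in> dom_y S) \<and>
     reward_th S \<in> borel_measurable borel \<and> reward_ph S \<in> borel_measurable borel \<and>
     (\<forall>\<mu>. dist_on (dom_xy S) \<mu> \<longrightarrow>
        (\<forall>\<theta>\<in>par_th S. integrable \<mu> (loss_th S \<theta>)) \<and> (\<forall>\<phi>\<in>par_ph S. integrable \<mu> (loss_ph S \<phi>))) \<and>
     dist_on (dom_xy S) (real_th S) \<and> dist_on (dom_xy S) (real_ph S) \<and>
     dist_on (dom_y S) (eval_th S) \<and> dist_on (dom_x S) (eval_ph S) \<and>
     draws S \<ge> 1"

definition law_th :: "('th, 'ph, 'x::topological_space, 'y, 'u, 'v) two_model_system \<Rightarrow> 'th \<Rightarrow> 'y \<Rightarrow> 'x measure" where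
  "law_th S = cond_law (noise_th S) (out_th S)"

definition law_ph :: "('th, 'ph, 'x, 'y::topological_space, 'u, 'v) two_model_system \<Rightarrow> 'ph \<Rightarrow> 'x \<Rightarrow> 'y measure" where
  "law_ph S = cond_law (noise_ph S) (out_ph S)"

context
  fixes S :: "('th::euclidean_space, 'ph::euclidean_space, 'x::euclidean_space, 'y::euclidean_space, 'u, 'v) two_model_system"
begin

text \<open>Pairs generated by each model, without and with curation, from the current training
  distribution \<open>P\<close> of model \<open>\<theta>\<close> (resp. \<open>Q\<close> of model \<open>\<phi>\<close>), whose input marginal is the input law.\<close>

definition synth_th :: "'th \<Rightarrow> ('x \<times> 'y) measure \<Rightarrow> ('x \<times> 'y) measure" where
  "synth_th \<theta> P = joint_law (\<lambda>y x. (x, y)) (distr P borel snd) (law_th S \<theta>)"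

definition synth_ph :: "'ph \<Rightarrow> ('x \<times> 'y) measure \<Rightarrow> ('x \<times> 'y) measure" where
  "synth_ph \<phi> Q = joint_law (\<lambda>x y. (x, y)) (distr Q borel fst) (law_ph S \<phi>)"

definition curated_th :: "'th \<Rightarrow> ('x \<times> 'y) measure \<Rightarrow> ('x \<times> 'y) measure" where
  "curated_th \<theta> P = joint_law (\<lambda>y x. (x, y)) (distr P borel snd)
     (\<lambda>y. curated_law (draws S) (\<lambda>x. reward_th S (x, y)) (law_th S \<theta> y))"

definition curated_ph :: "'ph \<Rightarrow> ('x \<times> 'y) measure \<Rightarrow> ('x \<times> 'y) measure" where
  "curated_ph \<phi> Q = joint_law (\<lambda>x y. (x, y)) (distr Q borel fst)
     (\<lambda>x. curated_law (draws S) (\<lambda>y. reward_ph S (x, y)) (law_ph S \<phi> x))"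

end

record weights =
  w_real :: real
  w_synth :: real
  w_cur :: real

definition mix_weights :: "weights \<Rightarrow> bool" where
  "mix_weights w \<longleftrightarrow> 0 \<le> w_real w \<and> 0 \<le> w_synth w \<and> 0 \<le> w_cur w \<and> w_real w + w_synth w + w_cur w = 1"

definition purely_real :: weights where
  "purely_real = \<lparr>w_real = 1, w_synth = 0, w_cur = 0\<rparr>"

context
  fixes S :: "('th::euclidean_space, 'ph::euclidean_space, 'x::euclidean_space, 'y::euclidean_space, 'u, 'v) two_model_system"
    and a b :: real  \<comment> \<open>fraction of \<open>\<theta>\<close>'s generated data coming from \<open>\<phi>\<close>, and of \<open>\<phi>\<close>'s coming from \<open>\<theta>\<close>\<close>
begin

text \<open>The training distributions built with model parameters \<open>(\<theta>, \<phi>)\<close>; the inputs of the models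
  come from the current training distributions \<open>P\<close>, \<open>Q\<close>.\<close>

definition next_P :: "weights \<Rightarrow> 'th \<Rightarrow> 'ph \<Rightarrow> ('x \<times> 'y) measure \<Rightarrow> ('x \<times> 'y) measure \<Rightarrow> ('x \<times> 'y) measure" where
  "next_P w \<theta> \<phi> P Q = mixture
     [(w_real w, real_th S),
      (w_synth w, mixture [(1 - a, synth_th S \<theta> P), (a, synth_ph S \<phi> Q)]),
      (w_cur w, mixture [(1 - a, curated_th S \<theta> P), (a, curated_ph S \<phi> Q)])]"

definition next_Q :: "weights \<Rightarrow> 'th \<Rightarrow> 'ph \<Rightarrow> ('x \<times> 'y) measure \<Rightarrow> ('x \<times> 'y) measure \<Rightarrow> ('x \<times> 'y) measure" where
  "next_Q w \<theta> \<phi> P Q = mixture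
     [(w_real w, real_ph S),
      (w_synth w, mixture [(1 - b, synth_ph S \<phi> Q), (b, synth_th S \<theta> P)]),
      (w_cur w, mixture [(1 - b, curated_ph S \<phi> Q), (b, curated_th S \<theta> P)])]"

end

text \<open>Sensitivity of a family of training distributions, for any current distributions the
  inputs are drawn from.\<close>

definition sensitive ::
  "('th::euclidean_space, 'ph::euclidean_space, 'x::euclidean_space, 'y::euclidean_space, 'u, 'v) two_model_system
   \<Rightarrow> real \<Rightarrow> ('th \<Rightarrow> 'ph \<Rightarrow> ('x \<times> 'y) measure \<Rightarrow> ('x \<times> 'y) measure \<Rightarrow> ('x \<times> 'y) measure) \<Rightarrow> bool" where
  "sensitive S \<epsilon> D \<longleftrightarrow>
     (\<forall>P Q. dist_on (dom_xy S) P \<longrightarrow> dist_on (dom_xy S) Q \<longrightarrow>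
       (\<forall>\<theta>\<in>par_th S. \<forall>\<theta>'\<in>par_th S. \<forall>\<phi>\<in>par_ph S. \<forall>\<phi>'\<in>par_ph S.
          wasserstein1 (D \<theta> \<phi> P Q) (D \<theta>' \<phi>' P Q) \<le> ennreal (\<epsilon> * norm ((\<theta>, \<phi>) - (\<theta>', \<phi>')))))"

text \<open>\<open>g \<theta> z\<close> is the gradient of \<open>l \<theta> z\<close> with respect to \<open>\<theta>\<close>, one-sided at the boundary of the
  parameter set.\<close>

definition loss_gradient ::
  "'par::euclidean_space set \<Rightarrow> 'z set \<Rightarrow> ('par \<Rightarrow> 'z \<Rightarrow> real) \<Rightarrow> ('par \<Rightarrow> 'z \<Rightarrow> 'par) \<Rightarrow> bool" where
  "loss_gradient T Z l g \<longleftrightarrow>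
     (\<forall>\<theta>\<in>T. \<forall>z\<in>Z. ((\<lambda>t. l t z) has_derivative (\<lambda>h. g \<theta> z \<bullet> h)) (at \<theta> within T))"

definition strongly_convex_loss ::
  "real \<Rightarrow> 'par::euclidean_space set \<Rightarrow> 'z set \<Rightarrow> ('par \<Rightarrow> 'z \<Rightarrow> real) \<Rightarrow> ('par \<Rightarrow> 'z \<Rightarrow> 'par) \<Rightarrow> bool" where
  "strongly_convex_loss \<gamma> T Z l g \<longleftrightarrow> \<gamma> > 0 \<and>
     (\<forall>z\<in>Z. \<forall>\<theta>\<in>T. \<forall>\<theta>'\<in>T.
        l \<theta> z \<ge> l \<theta>' z + g \<theta>' z \<bullet> (\<theta> - \<theta>') + \<gamma> / 2 * (norm (\<theta> - \<theta>'))\<^sup>2)"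

definition smooth_loss ::
  "real \<Rightarrow> 'par::euclidean_space set \<Rightarrow> 'z::real_normed_vector set \<Rightarrow> ('par \<Rightarrow> 'z \<Rightarrow> 'par) \<Rightarrow> bool" where
  "smooth_loss L T Z g \<longleftrightarrow>
     (\<forall>\<theta>\<in>T. \<forall>z\<in>Z. \<forall>z'\<in>Z. norm (g \<theta> z - g \<theta> z') \<le> L * norm (z - z')) \<and>
     (\<forall>z\<in>Z. \<forall>\<theta>\<in>T. \<forall>\<theta>'\<in>T. norm (g \<theta> z - g \<theta>' z) \<le> L * norm (\<theta> - \<theta>'))"

definition lipschitz_model ::
  "real \<Rightarrow> 'i::real_normed_vector set \<Rightarrow> 'par::real_normed_vector set \<Rightarrow> 'n measure
   \<Rightarrow> ('i \<Rightarrow> 'par \<Rightarrow> 'n \<Rightarrow> 'o::real_normed_vector) \<Rightarrow> bool" where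
  "lipschitz_model L I T N f \<longleftrightarrow>
     (\<forall>\<xi>\<in>space N. \<forall>i\<in>I. \<forall>i'\<in>I. \<forall>\<theta>\<in>T. \<forall>\<theta>'\<in>T.
        norm (f i \<theta> \<xi> - f i' \<theta>' \<xi>) \<le> L * (norm (i - i') + norm (\<theta> - \<theta>')))"

definition risk_minimizer :: "('par \<Rightarrow> 'z \<Rightarrow> real) \<Rightarrow> 'par set \<Rightarrow> 'z measure \<Rightarrow> 'par \<Rightarrow> bool" where
  "risk_minimizer l T \<mu> \<theta> \<longleftrightarrow> is_arg_min (\<lambda>t. \<integral>z. l t z \<partial>\<mu>) (\<lambda>t. t \<in> T) \<theta>"

datatype schedule = Synchronous | Theta_First | Phi_First

context
  fixes S :: "('th::euclidean_space, 'ph::euclidean_space, 'x::euclidean_space, 'y::euclidean_space, 'u, 'v) two_model_system"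
    and a b :: real
begin

text \<open>In the asynchronous schedules the model trained second sees data generated with the freshly
  updated parameter of the other one; the inputs are in all cases those of round \<open>t\<close>.\<close>

definition training_loop :: "schedule \<Rightarrow> weights \<Rightarrow> weights \<Rightarrow> (nat \<Rightarrow> 'th) \<Rightarrow> (nat \<Rightarrow> 'ph)
    \<Rightarrow> (nat \<Rightarrow> ('x \<times> 'y) measure) \<Rightarrow> (nat \<Rightarrow> ('x \<times> 'y) measure) \<Rightarrow> bool" where
  "training_loop sched w\<^sub>\<theta> w\<^sub>\<phi> \<theta> \<phi> P Q \<longleftrightarrow>
     \<theta> 0 \<in> par_th S \<and> \<phi> 0 \<in> par_ph S \<and> dist_on (dom_xy S) (P 0) \<and> dist_on (dom_xy S) (Q 0) \<and>
     (\<forall>t. P (Suc t) = next_P S a w\<^sub>\<theta> (\<theta> t) (if sched = Phi_First then \<phi> (Suc t) else \<phi> t) (P t) (Q t)) \<and>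
     (\<forall>t. Q (Suc t) = next_Q S b w\<^sub>\<phi> (if sched = Theta_First then \<theta> (Suc t) else \<theta> t) (\<phi> t) (P t) (Q t)) \<and>
     (\<forall>t. risk_minimizer (loss_th S) (par_th S) (P (Suc t)) (\<theta> (Suc t))) \<and>
     (\<forall>t. risk_minimizer (loss_ph S) (par_ph S) (Q (Suc t)) (\<phi> (Suc t)))"

definition stable_point :: "weights \<Rightarrow> weights \<Rightarrow> 'th \<times> 'ph \<Rightarrow> bool" where
  "stable_point w\<^sub>\<theta> w\<^sub>\<phi> s \<longleftrightarrow>
     (\<exists>P Q. dist_on (dom_xy S) P \<and> dist_on (dom_xy S) Q \<and>
        P = next_P S a w\<^sub>\<theta> (fst s) (snd s) P Q \<and> Q = next_Q S b w\<^sub>\<phi> (fst s) (snd s) P Q \<and>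
        risk_minimizer (loss_th S) (par_th S) P (fst s) \<and> risk_minimizer (loss_ph S) (par_ph S) Q (snd s))"

definition the_stable_point :: "weights \<Rightarrow> weights \<Rightarrow> 'th \<times> 'ph" where
  "the_stable_point w\<^sub>\<theta> w\<^sub>\<phi> = (THE s. stable_point w\<^sub>\<theta> w\<^sub>\<phi> s)"

abbreviation theta_star :: "weights \<Rightarrow> weights \<Rightarrow> 'th" where
  "theta_star w\<^sub>\<theta> w\<^sub>\<phi> \<equiv> fst (the_stable_point w\<^sub>\<theta> w\<^sub>\<phi>)"

abbreviation phi_star :: "weights \<Rightarrow> weights \<Rightarrow> 'ph" where
  "phi_star w\<^sub>\<theta> w\<^sub>\<phi> \<equiv> snd (the_stable_point w\<^sub>\<theta> w\<^sub>\<phi>)"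

definition convergence_threshold :: "schedule \<Rightarrow> real \<Rightarrow> bool" where
  "convergence_threshold sched \<tau> \<longleftrightarrow>
     (\<forall>w\<^sub>\<theta> w\<^sub>\<phi>. mix_weights w\<^sub>\<theta> \<longrightarrow> mix_weights w\<^sub>\<phi> \<longrightarrow> \<tau> < min (w_real w\<^sub>\<theta>) (w_real w\<^sub>\<phi>) \<longrightarrow>
        (\<exists>!s. stable_point w\<^sub>\<theta> w\<^sub>\<phi> s) \<and>
        (\<forall>\<theta> \<phi> P Q. training_loop sched w\<^sub>\<theta> w\<^sub>\<phi> \<theta> \<phi> P Q \<longrightarrow>
           (\<lambda>t. (\<theta> t, \<phi> t)) \<longlonglongrightarrow> the_stable_point w\<^sub>\<theta> w\<^sub>\<phi>))"

end

definition J_p :: "('th::euclidean_space, 'ph::euclidean_space, 'x::euclidean_space, 'y::euclidean_space, 'u, 'v) two_model_system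
    \<Rightarrow> 'th \<Rightarrow> real" where
  "J_p S \<theta> = (\<integral>y. (\<integral>x. reward_th S (x, y) \<partial>law_th S \<theta> y) \<partial>eval_th S)"

definition J_q :: "('th::euclidean_space, 'ph::euclidean_space, 'x::euclidean_space, 'y::euclidean_space, 'u, 'v) two_model_system
    \<Rightarrow> 'ph \<Rightarrow> real" where
  "J_q S \<phi> = (\<integral>x. (\<integral>y. reward_ph S (x, y) \<partial>law_ph S \<phi> x) \<partial>eval_ph S)"

end

theory Submission
  imports Defs
begin

text \<open>Let \<open>\<theta>\<^sub>1\<close> and \<open>\<theta>\<^sub>w\<close> minimize the expected loss under the real data \<open>R\<close> and under the stable
  training distribution \<open>P\<close> for real-data weight \<open>w\<close>. Smoothness in the data makes
  \<open>h z = l \<theta>\<^sub>1 z - l \<theta>\<^sub>w z\<close> Lipschitz in \<open>z\<close> with a constant proportional to \<open>\<parallel>\<theta>\<^sub>1 - \<theta>\<^sub>w\<parallel>\<close>, so on a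
  bounded domain its oscillation is \<open>O(\<parallel>\<theta>\<^sub>1 - \<theta>\<^sub>w\<parallel>)\<close>. As \<open>P\<close> dominates \<open>w R\<close>, the two expectations of \<open>h\<close>
  differ by at most \<open>(1 - w)\<close> times a multiple of this oscillation, whereas strong convexity bounds
  their difference from below by a multiple of \<open>\<parallel>\<theta>\<^sub>1 - \<theta>\<^sub>w\<parallel>\<^sup>2\<close>. Hence \<open>\<parallel>\<theta>\<^sub>1 - \<theta>\<^sub>w\<parallel> = O(1 - w)\<close>,
  whatever the synthetic part of \<open>P\<close> is, and the alignment is Lipschitz in the parameter.\<close>

section \<open>Mixtures and domination by the real-data component\<close>

text \<open>Countable additivity of the weighted sum is not proved but read off from
  \<open>dist_on\<close>: total mass 1 rules out the default zero measure. Nested components can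
  therefore stay opaque.\<close>

lemma emeasure_mixture:
  assumes "dist_on D (mixture cs)" "A \<in> sets borel"
  shows "emeasure (mixture cs) A = (\<Sum>(c, \<mu>)\<leftarrow>cs. ennreal c * emeasure \<mu> A)"
proof -
  let ?f = "\<lambda>A. \<Sum>(c, \<mu>)\<leftarrow>cs. ennreal c * emeasure \<mu> A"
  interpret prob_space "mixture cs" using assms(1) by (simp add: dist_on_def)
  \<comment> \<open>\<open>measure_of\<close> yields the zero measure unless the given set function is a measure\<close>
  have eq: "emeasure (mixture cs) X = (if X \<in> sigma_sets UNIV (sets borel) \<and>
      measure_space UNIV (sigma_sets UNIV (sets borel)) ?f then ?f X else 0)" for X
    unfolding mixture_def by (simp only: emeasure_measure_of_conv)
  have "measure_space UNIV (sigma_sets UNIV (sets borel)) ?f"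
    using emeasure_space_1 eq[of "space (mixture cs)"] by (auto split: if_splits)
  then show ?thesis using eq[of A] assms(2) by auto
qed

text \<open>The other summands are nonnegative in \<open>ennreal\<close>. With the real data as the
  head, this is the only information about a training distribution that enters the estimate.\<close>

lemma mixture_head_le:
  assumes "dist_on D (mixture ((c, \<nu>) # cs))" "dist_on D \<nu>"
  shows "scale_measure (ennreal c) \<nu> \<le> mixture ((c, \<nu>) # cs)"
proof (subst le_measure)
  show "sets (scale_measure (ennreal c) \<nu>) = sets (mixture ((c, \<nu>) # cs))"
    using assms by (simp add: dist_on_def)
  show "\<forall>A\<in>sets (scale_measure (ennreal c) \<nu>).
      emeasure (scale_measure (ennreal c) \<nu>) A \<le> emeasure (mixture ((c, \<nu>) # cs)) A"
    using assms by (auto simp: emeasure_mixture[OF assms(1)] dist_on_def)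
qed

text \<open>Describes purely real training. The tail may contain any measures, because a zero
  coefficient annihilates even an infinite value in \<open>ennreal\<close>.\<close>

lemma mixture_eq_head:
  assumes "dist_on D (mixture ((1, \<nu>) # cs))" "dist_on D \<nu>" "\<And>c \<mu>. (c, \<mu>) \<in> set cs \<Longrightarrow> c = 0"
  shows "mixture ((1, \<nu>) # cs) = \<nu>"
proof (rule measure_eqI)
  show "sets (mixture ((1, \<nu>) # cs)) = sets \<nu>" using assms by (simp add: dist_on_def)
  fix A assume "A \<in> sets (mixture ((1, \<nu>) # cs))"
  then have "A \<in> sets borel" using assms(1) by (simp add: dist_on_def)
  moreover have "(\<Sum>(c, \<mu>)\<leftarrow>cs. ennreal c * emeasure \<mu> A) = 0"
    using assms(3) by (induction cs) fastforce+
  ultimately show "emeasure (mixture ((1, \<nu>) # cs)) A = emeasure \<nu> A"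
    by (simp add: emeasure_mixture[OF assms(1)])
qed

text \<open>The excess of \<open>P\<close> over \<open>w\<close> times \<open>R\<close> has mass
  \<open>1 - w\<close>. Integrating the nonnegative function \<open>M - h\<close> against the
  domination and rearranging leaves \<open>1 - w\<close> times the \<open>R\<close>-expectation of
  \<open>M - h\<close>, which is at most \<open>2 * M\<close>.\<close>

lemma expectation_diff_le_of_dominates:
  fixes h :: "'a \<Rightarrow> real"
  assumes "prob_space P" "prob_space R" "sets P = sets R"
    and dom: "scale_measure (ennreal w) R \<le> P" and w: "0 \<le> w" "w \<le> 1"
    and int: "integrable P h" "integrable R h"
    and bnd: "AE z in P. \<bar>h z\<bar> \<le> M" "AE z in R. \<bar>h z\<bar> \<le> M"
  shows "(\<integral>z. h z \<partial>P) - (\<integral>z. h z \<partial>R) \<le> 2 * M * (1 - w)"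
proof -
  interpret P: prob_space P by fact
  interpret R: prob_space R by fact
  \<comment> \<open>Domination of measures only compares integrals of nonnegative functions, hence
    the shift from \<open>h\<close> to \<open>M - h\<close>.\<close>
  have nnP: "(\<integral>\<^sup>+z. ennreal (M - h z) \<partial>P) = ennreal (\<integral>z. M - h z \<partial>P)"
    by (rule nn_integral_eq_integral) (use int bnd in auto)
  have nnR: "(\<integral>\<^sup>+z. ennreal (M - h z) \<partial>R) = ennreal (\<integral>z. M - h z \<partial>R)"
    by (rule nn_integral_eq_integral) (use int bnd in auto)
  have pos: "0 \<le> (\<integral>z. M - h z \<partial>P)"
    by (rule integral_nonneg_AE) (use bnd in auto)
  have "ennreal (w * (\<integral>z. M - h z \<partial>R)) = ennreal w * (\<integral>\<^sup>+z. ennreal (M - h z) \<partial>R)"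
    using w by (simp add: nnR ennreal_mult')
  also have "\<dots> = (\<integral>\<^sup>+z. ennreal (M - h z) \<partial>scale_measure (ennreal w) R)"
    using int by (simp add: nn_integral_scale_measure)
  also have "\<dots> \<le> (\<integral>\<^sup>+z. ennreal (M - h z) \<partial>P)"
    by (rule nn_integral_mono_measure) (use assms in auto)
  finally have "w * (\<integral>z. M - h z \<partial>R) \<le> (\<integral>z. M - h z \<partial>P)"
    using pos by (simp add: nnP)
  then have "w * (M - (\<integral>z. h z \<partial>R)) \<le> M - (\<integral>z. h z \<partial>P)"
    using int by (simp add: P.prob_space R.prob_space)
  then have "(\<integral>z. h z \<partial>P) - (\<integral>z. h z \<partial>R) \<le> (1 - w) * (M - (\<integral>z. h z \<partial>R))"
    by (simp add: algebra_simps)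
  also have "\<dots> \<le> (1 - w) * (2 * M)"
  proof (rule mult_left_mono)
    have "(\<integral>z. - M \<partial>R) \<le> (\<integral>z. h z \<partial>R)"
      by (rule integral_mono_AE) (use int bnd in auto)
    then show "M - (\<integral>z. h z \<partial>R) \<le> 2 * M" by (simp add: R.prob_space)
  qed (use w in simp)
  finally show ?thesis by (simp add: algebra_simps)
qed

section \<open>Stability of risk minimizers under strongly convex, smooth losses\<close>

text \<open>Strong convexity based at the midpoint is applied towards both endpoints. The
  displacements are opposite, so the gradient terms cancel on averaging, and halving the distance
  turns the factor 1/2 into 1/8. The resulting inequality is free of gradients and can be integrated
  directly.\<close>

lemma strongly_convex_loss_midpoint:
  fixes T :: "'par::euclidean_space set"
  assumes "strongly_convex_loss \<gamma> T Z l g" "convex T" "s \<in> T" "t \<in> T" "z \<in> Z"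
  shows "l (midpoint s t) z \<le> (l s z + l t z) / 2 - \<gamma> / 8 * (norm (s - t))\<^sup>2"
proof -
  let ?m = "midpoint s t"
  have m: "?m \<in> T"
    using convexD[OF assms(2), of s t "1/2" "1/2"] assms by (simp add: midpoint_def algebra_simps)
  have s: "s - ?m = (1/2) *\<^sub>R (s - t)" and t: "t - ?m = - ((1/2) *\<^sub>R (s - t))"
    by (simp_all add: midpoint_def algebra_simps flip: scaleR_add_left)
  have sc: "l u z \<ge> l ?m z + g ?m z \<bullet> (u - ?m) + \<gamma> / 2 * (norm (u - ?m))\<^sup>2" if "u \<in> T" for u
    using assms that m by (auto simp: strongly_convex_loss_def)
  have "l s z \<ge> l ?m z + g ?m z \<bullet> (s - t) / 2 + \<gamma> / 8 * (norm (s - t))\<^sup>2"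
    using sc[OF assms(3)] unfolding s inner_scaleR_right norm_scaleR power_mult_distrib
    by (simp add: power2_eq_square)
  moreover have "l t z \<ge> l ?m z - g ?m z \<bullet> (s - t) / 2 + \<gamma> / 8 * (norm (s - t))\<^sup>2"
    using sc[OF assms(4)] unfolding t inner_minus_right norm_minus_cancel inner_scaleR_right norm_scaleR
      power_mult_distrib
    by (simp add: power2_eq_square)
  ultimately show ?thesis by (simp add: field_simps)
qed

text \<open>The minimizer is compared with the midpoint, whose risk is at most the average risk
  minus the \<gamma>/8 term; doubling gives \<gamma>/4. First-order optimality would give
  \<gamma>/2, but would require exchanging gradient and expectation.\<close>

lemma risk_minimizer_quadratic_growth:
  fixes T :: "'par::euclidean_space set"
  assumes sc: "strongly_convex_loss \<gamma> T Z l g" and "convex T" and \<mu>: "dist_on Z \<mu>"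
    and int: "\<And>u. u \<in> T \<Longrightarrow> integrable \<mu> (l u)"
    and min: "risk_minimizer l T \<mu> s" and t: "t \<in> T"
  shows "(\<integral>z. l s z \<partial>\<mu>) + \<gamma> / 4 * (norm (s - t))\<^sup>2 \<le> (\<integral>z. l t z \<partial>\<mu>)"
proof -
  interpret prob_space \<mu> using \<mu> by (simp add: dist_on_def)
  have s: "s \<in> T" and le: "\<And>u. u \<in> T \<Longrightarrow> (\<integral>z. l s z \<partial>\<mu>) \<le> (\<integral>z. l u z \<partial>\<mu>)"
    using min by (auto simp: risk_minimizer_def is_arg_min_linorder)
  have m: "midpoint s t \<in> T"
    using convexD[OF assms(2), of s t "1/2" "1/2"] s t by (simp add: midpoint_def algebra_simps)
  have "(\<integral>z. l (midpoint s t) z \<partial>\<mu>) \<le> (\<integral>z. (l s z + l t z) / 2 - \<gamma> / 8 * (norm (s - t))\<^sup>2 \<partial>\<mu>)"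
  proof (rule integral_mono_AE)
    show "AE z in \<mu>. l (midpoint s t) z \<le> (l s z + l t z) / 2 - \<gamma> / 8 * (norm (s - t))\<^sup>2"
      using \<mu> strongly_convex_loss_midpoint[OF sc \<open>convex T\<close> s t] by (auto simp: dist_on_def)
  qed (use int m s t in auto)
  also have "\<dots> = ((\<integral>z. l s z \<partial>\<mu>) + (\<integral>z. l t z \<partial>\<mu>)) / 2 - \<gamma> / 8 * (norm (s - t))\<^sup>2"
    using int s t by (simp add: prob_space)
  finally show ?thesis using le[OF m] by (simp add: field_simps)
qed

text \<open>Mean value inequality on the convex set \<open>T\<close> for the function sending
  \<open>u\<close> to \<open>l u z - l u z'\<close>, whose gradient is bounded by smoothness in the
  data.\<close>

lemma smooth_loss_diff_lipschitz:
  fixes T :: "'par::euclidean_space set" and Z :: "'z::real_normed_vector set"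
  assumes "loss_gradient T Z l g" "smooth_loss L T Z g" "convex T"
    and "s \<in> T" "t \<in> T" "z \<in> Z" "z' \<in> Z"
  shows "\<bar>(l s z - l t z) - (l s z' - l t z')\<bar> \<le> L * norm (z - z') * norm (s - t)"
proof -
  \<comment> \<open>The mixed difference is regrouped as an increment in the parameter with both
    data points fixed.\<close>
  have "norm ((l s z - l s z') - (l t z - l t z')) \<le> L * norm (z - z') * norm (s - t)"
  proof (rule differentiable_bound[OF \<open>convex T\<close>])
    fix u assume u: "u \<in> T"
    show "((\<lambda>u. l u z - l u z') has_derivative (\<lambda>h. (g u z - g u z') \<bullet> h)) (at u within T)"
      using assms u unfolding loss_gradient_def
      by (auto intro!: derivative_eq_intros simp: inner_diff_left)
    have "onorm (\<lambda>h. (g u z - g u z') \<bullet> h) \<le> norm (g u z - g u z')"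
      by (rule onorm_bound) (auto simp: Cauchy_Schwarz_ineq2)
    also have "\<dots> \<le> L * norm (z - z')"
      using assms u by (auto simp: smooth_loss_def)
    finally show "onorm (\<lambda>h. (g u z - g u z') \<bullet> h) \<le> L * norm (z - z')" .
  qed (use assms in auto)
  then show ?thesis by (simp add: algebra_simps)
qed

lemma dist_on_nonempty:
  assumes "dist_on A \<mu>"
  shows "A \<noteq> {}"
proof
  assume "A = {}"
  with assms have "AE z in \<mu>. False" and "prob_space \<mu>" by (auto simp: dist_on_def)
  then show False using prob_space.AE_False by blast
qed

text \<open>Quadratic growth at \<open>s\<close> under \<open>P\<close> and at \<open>t\<close>
  under \<open>R\<close> adds up to a lower bound quadratic in the distance, while the upper bound
  from domination is linear in it. Cancelling one factor gives a rate linear in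
  \<open>1 - w\<close>, not merely its square root.\<close>

lemma risk_minimizer_dist_le:
  fixes T :: "'par::euclidean_space set" and Z :: "'z::real_normed_vector set"
  assumes grad: "loss_gradient T Z l g" and sc: "strongly_convex_loss \<gamma> T Z l g"
    and smooth: "smooth_loss L T Z g" and T: "convex T" and Z: "bounded Z"
    and int: "\<And>\<mu> u. dist_on Z \<mu> \<Longrightarrow> u \<in> T \<Longrightarrow> integrable \<mu> (l u)"
    and P: "dist_on Z P" and R: "dist_on Z R"
    and dom: "scale_measure (ennreal w) R \<le> P" and w: "0 \<le> w" "w \<le> 1"
    and s: "risk_minimizer l T P s" and t: "risk_minimizer l T R t"
  shows "norm (s - t) \<le> 4 * \<bar>L\<bar> * diameter Z / \<gamma> * (1 - w)"
proof -
  interpret P: prob_space P using P by (simp add: dist_on_def)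
  interpret R: prob_space R using R by (simp add: dist_on_def)
  have sT: "s \<in> T" and tT: "t \<in> T"
    using s t by (auto simp: risk_minimizer_def is_arg_min_def)
  obtain z0 where z0: "z0 \<in> Z" using dist_on_nonempty[OF R] by blast
  \<comment> \<open>Centring at \<open>z0\<close> changes both expectations by the same constant,
    but turns the oscillation bound into the absolute bound \<open>?M\<close>.\<close>
  let ?d = "norm (s - t)" and ?h = "\<lambda>z. (l t z - l s z) - (l t z0 - l s z0)"
  let ?M = "\<bar>L\<bar> * diameter Z * ?d"
  have h: "\<bar>?h z\<bar> \<le> ?M" if "z \<in> Z" for z
  proof -
    have "\<bar>?h z\<bar> \<le> L * norm (z - z0) * ?d"
      using smooth_loss_diff_lipschitz[OF grad smooth T tT sT that z0] by (simp add: norm_minus_commute)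
    also have "\<dots> \<le> \<bar>L\<bar> * diameter Z * ?d"
      using diameter_bounded_bound[OF Z that z0]
      by (intro mult_right_mono mult_mono) (auto simp: dist_norm)
    finally show ?thesis .
  qed
  have "(\<integral>z. ?h z \<partial>P) - (\<integral>z. ?h z \<partial>R) \<le> 2 * ?M * (1 - w)"
  proof (rule expectation_diff_le_of_dominates[OF _ _ _ dom w])
    show "AE z in P. \<bar>?h z\<bar> \<le> ?M" "AE z in R. \<bar>?h z\<bar> \<le> ?M"
      using P R h by (auto simp: dist_on_def)
  qed (use P R int sT tT in \<open>auto simp: dist_on_def\<close>)
  moreover have "(\<integral>z. ?h z \<partial>P) = (\<integral>z. l t z \<partial>P) - (\<integral>z. l s z \<partial>P) - (l t z0 - l s z0)"
    using int[OF P] sT tT by (simp add: P.prob_space)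
  moreover have "(\<integral>z. ?h z \<partial>R) = (\<integral>z. l t z \<partial>R) - (\<integral>z. l s z \<partial>R) - (l t z0 - l s z0)"
    using int[OF R] sT tT by (simp add: R.prob_space)
  ultimately have "\<gamma> / 2 * ?d\<^sup>2 \<le> 2 * ?M * (1 - w)"
    using risk_minimizer_quadratic_growth[OF sc T P int[OF P] s tT]
      risk_minimizer_quadratic_growth[OF sc T R int[OF R] t sT]
    by (simp add: norm_minus_commute)
  then have "?d * (\<gamma> * ?d) \<le> ?d * (4 * \<bar>L\<bar> * diameter Z * (1 - w))"
    by (simp add: power2_eq_square algebra_simps)
  \<comment> \<open>Handles \<open>?d = 0\<close>, where the common factor cannot be
    cancelled.\<close>
  moreover have "0 \<le> 4 * \<bar>L\<bar> * diameter Z * (1 - w)"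
    using w diameter_ge_0[OF Z] by simp
  ultimately have "\<gamma> * ?d \<le> 4 * \<bar>L\<bar> * diameter Z * (1 - w)"
    by (cases "?d = 0") (auto simp: mult_le_cancel_left)
  moreover have "\<gamma> > 0" using sc by (simp add: strongly_convex_loss_def)
  ultimately show ?thesis by (simp add: field_simps)
qed

section \<open>Lipschitz dependence of the alignment on the parameter\<close>

lemma (in prob_space) expectation_norm_le:
  fixes f :: "'a \<Rightarrow> real"
  assumes "integrable M f" "AE x in M. norm (f x) \<le> K"
  shows "norm (expectation f) \<le> K"
proof -
  have "norm (expectation f) \<le> expectation (\<lambda>x. norm (f x))"
    by (rule integral_norm_bound)
  also have "\<dots> \<le> expectation (\<lambda>x. K)"
    by (rule integral_mono_AE) (use assms in auto)
  finally show ?thesis by (simp add: prob_space)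
qed

text \<open>Synchronous coupling: both parameters are evaluated on the same input and the same noise
  realization, so the Lipschitz bounds compose pointwise. The bound \<open>B\<close> serves
  integrability only and leaves the constant unaffected. Inputs and outputs are kept abstract to
  cover both models.\<close>

lemma expected_reward_lipschitz:
  fixes f :: "'i::euclidean_space \<Rightarrow> 'par::euclidean_space \<Rightarrow> 'n \<Rightarrow> 'o::euclidean_space"
    and r :: "'o \<Rightarrow> 'i \<Rightarrow> real"
  assumes N: "prob_space N" and E: "dist_on I E"
    and meas: "\<And>\<theta>. \<theta> \<in> T \<Longrightarrow> (\<lambda>(i, \<xi>). f i \<theta> \<xi>) \<in> borel \<Otimes>\<^sub>M N \<rightarrow>\<^sub>M borel"
    and r: "(\<lambda>(y, i). r y i) \<in> borel_measurable (borel \<Otimes>\<^sub>M borel)"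
    and out: "\<And>i \<theta> \<xi>. i \<in> I \<Longrightarrow> \<theta> \<in> T \<Longrightarrow> \<xi> \<in> space N \<Longrightarrow> f i \<theta> \<xi> \<in> D"
    and lip: "lipschitz_model L I T N f"
    and rlip: "\<And>i y y'. i \<in> I \<Longrightarrow> y \<in> D \<Longrightarrow> y' \<in> D \<Longrightarrow> \<bar>r y i - r y' i\<bar> \<le> R * norm (y - y')"
    and bnd: "\<And>i y. i \<in> I \<Longrightarrow> y \<in> D \<Longrightarrow> \<bar>r y i\<bar> \<le> B"
    and R: "0 \<le> R" and s: "s \<in> T" and t: "t \<in> T"
  shows "\<bar>(\<integral>i. (\<integral>y. r y i \<partial>cond_law N f s i) \<partial>E) - (\<integral>i. (\<integral>y. r y i \<partial>cond_law N f t i) \<partial>E)\<bar>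
    \<le> R * \<bar>L\<bar> * norm (s - t)"
proof -
  interpret N: prob_space N by fact
  interpret E: prob_space E using E by (simp add: dist_on_def)
  have setsE[measurable_cong]: "sets E = sets borel" and aeE: "AE i in E. i \<in> I"
    using E by (auto simp: dist_on_def)
  note r[measurable]
  let ?F = "\<lambda>\<theta> i. \<integral>\<xi>. r (f i \<theta> \<xi>) i \<partial>N"
  \<comment> \<open>Joint measurability is what makes the inner expectation \<open>?F\<close>
    measurable in the input.\<close>
  have m1[measurable]: "(\<lambda>(i, \<xi>). r (f i \<theta> \<xi>) i) \<in> borel_measurable (borel \<Otimes>\<^sub>M N)" if "\<theta> \<in> T" for \<theta>
  proof -
    note meas[OF that, measurable]
    have "(\<lambda>p. (\<lambda>(y, i). r y i) ((\<lambda>(i, \<xi>). f i \<theta> \<xi>) p, fst p)) \<in> borel_measurable (borel \<Otimes>\<^sub>M N)"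
      by measurable
    then show ?thesis by (simp add: case_prod_unfold)
  qed
  have m2: "(\<lambda>\<xi>. r (f i \<theta> \<xi>) i) \<in> borel_measurable N" if "\<theta> \<in> T" for i \<theta>
    using measurable_Pair2[OF m1[OF that], of i] by simp
  \<comment> \<open>Change of variables from the output law to the noise, which the two parameters
    share.\<close>
  have eq: "(\<integral>y. r y i \<partial>cond_law N f \<theta> i) = ?F \<theta> i" if "\<theta> \<in> T" for i \<theta>
    unfolding cond_law_def
  proof (rule integral_distr)
    show "f i \<theta> \<in> N \<rightarrow>\<^sub>M borel" using measurable_Pair2[OF meas[OF that], of i] by simp
    show "(\<lambda>y. r y i) \<in> borel_measurable borel" using measurable_Pair1[OF r, of i] by simp
  qed
  have int: "integrable N (\<lambda>\<xi>. r (f i \<theta> \<xi>) i)" if "\<theta> \<in> T" "i \<in> I" for i \<theta>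
    by (rule N.integrable_const_bound[of _ B]) (use that out bnd m2 in auto)
  have intE: "integrable E (?F \<theta>)" if "\<theta> \<in> T" for \<theta>
  proof (rule E.integrable_const_bound[of _ B])
    show "AE i in E. norm (?F \<theta> i) \<le> B"
      using aeE
    proof (rule AE_mp, intro AE_I2 impI)
      fix i assume i: "i \<in> I"
      show "norm (?F \<theta> i) \<le> B"
        by (rule N.expectation_norm_le) (use that i int out bnd in auto)
    qed
    show "?F \<theta> \<in> borel_measurable E"
      using N.borel_measurable_lebesgue_integral[OF m1[OF that]] setsE
      by (simp cong: measurable_cong_sets)
  qed
  have ptw: "norm (?F s i - ?F t i) \<le> R * \<bar>L\<bar> * norm (s - t)" if i: "i \<in> I" for i
  proof -
    have "norm (\<integral>\<xi>. r (f i s \<xi>) i - r (f i t \<xi>) i \<partial>N) \<le> R * \<bar>L\<bar> * norm (s - t)"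
    proof (rule N.expectation_norm_le, goal_cases)
      case 2
      show ?case
      proof (rule AE_I2)
        fix \<xi> assume \<xi>: "\<xi> \<in> space N"
        \<comment> \<open>The inputs coincide, so only the parameter term survives; the absolute
          value below covers a negative \<open>L\<close>.\<close>
        have "norm (f i s \<xi> - f i t \<xi>) \<le> L * (norm (i - i) + norm (s - t))"
          using lip \<xi> i s t unfolding lipschitz_model_def by blast
        also have "\<dots> \<le> \<bar>L\<bar> * norm (s - t)" by (simp add: mult_right_mono)
        finally have "R * norm (f i s \<xi> - f i t \<xi>) \<le> R * (\<bar>L\<bar> * norm (s - t))"
          using R by (rule mult_left_mono)
        with rlip[OF i out[OF i s \<xi>] out[OF i t \<xi>]]
        show "norm (r (f i s \<xi>) i - r (f i t \<xi>) i) \<le> R * \<bar>L\<bar> * norm (s - t)"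
          by (simp add: mult.assoc)
      qed
    qed (use int i s t in auto)
    then show ?thesis using int i s t by simp
  qed
  have "norm (\<integral>i. ?F s i - ?F t i \<partial>E) \<le> R * \<bar>L\<bar> * norm (s - t)"
    by (rule E.expectation_norm_le) (use intE s t aeE ptw in auto)
  then show ?thesis using intE s t by (simp add: eq)
qed

lemma lipschitz_on_bounded_image_bound:
  fixes r :: "'z::euclidean_space \<Rightarrow> real"
  assumes "R-lipschitz_on Z r" "bounded Z"
  obtains B where "\<And>z. z \<in> Z \<Longrightarrow> \<bar>r z\<bar> \<le> B"
proof -
  have "bounded (r ` Z)"
    using assms bounded_uniformly_continuous_image lipschitz_on_uniformly_continuous by blast
  then show thesis using that by (auto simp: bounded_iff)
qed

lemma J_p_lipschitz:
  fixes S :: "('th::euclidean_space, 'ph::euclidean_space, 'x::euclidean_space, 'y::euclidean_space, 'u, 'v) two_model_system"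
  assumes wf: "well_formed S" and bdd: "bounded (dom_xy S)"
    and lip: "lipschitz_model L (dom_y S) (par_th S) (noise_th S) (out_th S)"
    and rlip: "R-lipschitz_on (dom_xy S) (reward_th S)"
    and s: "s \<in> par_th S" and t: "t \<in> par_th S"
  shows "\<bar>J_p S s - J_p S t\<bar> \<le> R * \<bar>L\<bar> * norm (s - t)"
proof -
  obtain B where B: "\<And>z. z \<in> dom_xy S \<Longrightarrow> \<bar>reward_th S z\<bar> \<le> B"
    using lipschitz_on_bounded_image_bound[OF rlip bdd] by blast
  show ?thesis
    unfolding J_p_def law_th_def
  proof (rule expected_reward_lipschitz[OF _ _ _ _ _ lip _ _ _ s t])
    show "(\<lambda>(y, i). reward_th S (y, i)) \<in> borel_measurable (borel \<Otimes>\<^sub>M borel)"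
      using wf by (simp add: well_formed_def borel_prod)
    show "\<bar>reward_th S (y, i) - reward_th S (y', i)\<bar> \<le> R * norm (y - y')"
      if "i \<in> dom_y S" "y \<in> dom_x S" "y' \<in> dom_x S" for i y y'
      using lipschitz_onD[OF rlip, of "(y, i)" "(y', i)"] that
      by (simp add: dom_xy_def dist_norm norm_Pair)
    show "\<bar>reward_th S (y, i)\<bar> \<le> B" if "i \<in> dom_y S" "y \<in> dom_x S" for i y
      using B that by (simp add: dom_xy_def)
    show "0 \<le> R" using rlip by (rule lipschitz_on_nonneg)
  qed (use wf in \<open>auto simp: well_formed_def\<close>)
qed

lemma J_q_lipschitz:
  fixes S :: "('th::euclidean_space, 'ph::euclidean_space, 'x::euclidean_space, 'y::euclidean_space, 'u, 'v) two_model_system"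
  assumes wf: "well_formed S" and bdd: "bounded (dom_xy S)"
    and lip: "lipschitz_model L (dom_x S) (par_ph S) (noise_ph S) (out_ph S)"
    and rlip: "R-lipschitz_on (dom_xy S) (reward_ph S)"
    and s: "s \<in> par_ph S" and t: "t \<in> par_ph S"
  shows "\<bar>J_q S s - J_q S t\<bar> \<le> R * \<bar>L\<bar> * norm (s - t)"
proof -
  obtain B where B: "\<And>z. z \<in> dom_xy S \<Longrightarrow> \<bar>reward_ph S z\<bar> \<le> B"
    using lipschitz_on_bounded_image_bound[OF rlip bdd] by blast
  show ?thesis
    unfolding J_q_def law_ph_def
  proof (rule expected_reward_lipschitz[OF _ _ _ _ _ lip _ _ _ s t])
    \<comment> \<open>Data pairs are ordered \<open>(x, y)\<close> and here \<open>x\<close> is the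
      input, while the general lemma puts the output first; hence the swap.\<close>
    have "reward_ph S \<in> borel_measurable (borel \<Otimes>\<^sub>M borel)"
      using wf by (simp add: well_formed_def borel_prod)
    from measurable_compose[OF measurable_pair_swap' this]
    show "(\<lambda>(y, i). reward_ph S (i, y)) \<in> borel_measurable (borel \<Otimes>\<^sub>M borel)"
      by (simp add: case_prod_unfold)
    show "\<bar>reward_ph S (i, y) - reward_ph S (i, y')\<bar> \<le> R * norm (y - y')"
      if "i \<in> dom_x S" "y \<in> dom_y S" "y' \<in> dom_y S" for i y y'
      using lipschitz_onD[OF rlip, of "(i, y)" "(i, y')"] that
      by (simp add: dom_xy_def dist_norm norm_Pair)
    show "\<bar>reward_ph S (i, y)\<bar> \<le> B" if "i \<in> dom_x S" "y \<in> dom_y S" for i y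
      using B that by (simp add: dom_xy_def)
    show "0 \<le> R" using rlip by (rule lipschitz_on_nonneg)
  qed (use wf in \<open>auto simp: well_formed_def\<close>)
qed

section \<open>What stable points say about risk minimizers\<close>

text \<open>Reduces the self-consuming feedback to domination by real data: a stable training
  distribution is itself a mixture whose head is the weighted real distribution.\<close>

lemma stable_point_dominates:
  assumes "well_formed S" "stable_point S a b w\<^sub>\<theta> w\<^sub>\<phi> s"
  obtains P Q where "dist_on (dom_xy S) P" "dist_on (dom_xy S) Q"
    "scale_measure (ennreal (w_real w\<^sub>\<theta>)) (real_th S) \<le> P"
    "scale_measure (ennreal (w_real w\<^sub>\<phi>)) (real_ph S) \<le> Q"
    "risk_minimizer (loss_th S) (par_th S) P (fst s)"
    "risk_minimizer (loss_ph S) (par_ph S) Q (snd s)"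
proof -
  obtain P Q where PQ: "dist_on (dom_xy S) P" "dist_on (dom_xy S) Q"
    and P: "next_P S a w\<^sub>\<theta> (fst s) (snd s) P Q = P"
    and Q: "next_Q S b w\<^sub>\<phi> (fst s) (snd s) P Q = Q"
    and min: "risk_minimizer (loss_th S) (par_th S) P (fst s)"
    "risk_minimizer (loss_ph S) (par_ph S) Q (snd s)"
    \<comment> \<open>The fixed-point equations are reversed, since \<open>P\<close> and
      \<open>Q\<close> also occur inside the mixtures and rewriting from left to right would
      loop.\<close>
    using assms(2) unfolding stable_point_def by (elim exE conjE, intro that) (assumption | erule sym)+
  have real: "dist_on (dom_xy S) (real_th S)" "dist_on (dom_xy S) (real_ph S)"
    using assms(1) by (auto simp: well_formed_def)
  \<comment> \<open>The fixed-point equation transfers \<open>dist_on\<close> from \<open>P\<close>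
    to the mixture, as the mixture lemmas require.\<close>
  have "dist_on (dom_xy S) (next_P S a w\<^sub>\<theta> (fst s) (snd s) P Q)"
    unfolding P by (fact PQ)
  then have "scale_measure (ennreal (w_real w\<^sub>\<theta>)) (real_th S) \<le> next_P S a w\<^sub>\<theta> (fst s) (snd s) P Q"
    unfolding next_P_def by (rule mixture_head_le[OF _ real(1)])
  moreover have "dist_on (dom_xy S) (next_Q S b w\<^sub>\<phi> (fst s) (snd s) P Q)"
    unfolding Q by (fact PQ)
  then have "scale_measure (ennreal (w_real w\<^sub>\<phi>)) (real_ph S) \<le> next_Q S b w\<^sub>\<phi> (fst s) (snd s) P Q"
    unfolding next_Q_def by (rule mixture_head_le[OF _ real(2)])
  ultimately show thesis
    unfolding P Q by (rule that[OF PQ _ _ min])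
qed

text \<open>With weight 1 on real data each mixture collapses to its head, so the fixed point is the
  real distribution itself. This provides the reference minimizers.\<close>

lemma stable_point_purely_real:
  assumes "well_formed S" "stable_point S a b purely_real purely_real s"
  shows "risk_minimizer (loss_th S) (par_th S) (real_th S) (fst s)"
    and "risk_minimizer (loss_ph S) (par_ph S) (real_ph S) (snd s)"
proof -
  obtain P Q where PQ: "dist_on (dom_xy S) P" "dist_on (dom_xy S) Q"
    and P: "next_P S a purely_real (fst s) (snd s) P Q = P"
    and Q: "next_Q S b purely_real (fst s) (snd s) P Q = Q"
    and min: "risk_minimizer (loss_th S) (par_th S) P (fst s)"
    "risk_minimizer (loss_ph S) (par_ph S) Q (snd s)"
    using assms(2) unfolding stable_point_def by (elim exE conjE, intro that) (assumption | erule sym)+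
  have real: "dist_on (dom_xy S) (real_th S)" "dist_on (dom_xy S) (real_ph S)"
    using assms(1) by (auto simp: well_formed_def)
  have "dist_on (dom_xy S) (next_P S a purely_real (fst s) (snd s) P Q)"
    unfolding P by (fact PQ)
  then have "next_P S a purely_real (fst s) (snd s) P Q = real_th S"
    unfolding next_P_def purely_real_def weights.simps
    by (rule mixture_eq_head[OF _ real(1)]) auto
  moreover have "dist_on (dom_xy S) (next_Q S b purely_real (fst s) (snd s) P Q)"
    unfolding Q by (fact PQ)
  then have "next_Q S b purely_real (fst s) (snd s) P Q = real_ph S"
    unfolding next_Q_def purely_real_def weights.simps
    by (rule mixture_eq_head[OF _ real(2)]) auto
  ultimately show "risk_minimizer (loss_th S) (par_th S) (real_th S) (fst s)"
    and "risk_minimizer (loss_ph S) (par_ph S) (real_ph S) (snd s)"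
    unfolding P Q using min by simp_all
qed

theorem theorem4p8:
  fixes S :: "('th::euclidean_space, 'ph::euclidean_space, 'x::euclidean_space, 'y::euclidean_space, 'u, 'v) two_model_system"
    and grad_th :: "'th \<Rightarrow> 'x \<times> 'y \<Rightarrow> 'th" and grad_ph :: "'ph \<Rightarrow> 'x \<times> 'y \<Rightarrow> 'ph"
    and \<gamma>\<^sub>\<theta> \<gamma>\<^sub>\<phi> L\<^sub>\<theta> L\<^sub>\<phi> L R\<^sub>\<theta> R\<^sub>\<phi> \<epsilon>\<^sub>\<theta> \<epsilon>\<^sub>\<phi> \<tau> :: real
    and sched :: schedule
  assumes "well_formed S"
    and "loss_gradient (par_th S) (dom_xy S) (loss_th S) grad_th"
    and "loss_gradient (par_ph S) (dom_xy S) (loss_ph S) grad_ph"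
    and "strongly_convex_loss \<gamma>\<^sub>\<theta> (par_th S) (dom_xy S) (loss_th S) grad_th"
    and "strongly_convex_loss \<gamma>\<^sub>\<phi> (par_ph S) (dom_xy S) (loss_ph S) grad_ph"
    and "smooth_loss L\<^sub>\<theta> (par_th S) (dom_xy S) grad_th"
    and "smooth_loss L\<^sub>\<phi> (par_ph S) (dom_xy S) grad_ph"
    and "bounded (dom_x S)" and "bounded (dom_y S)"
    and "lipschitz_model L (dom_y S) (par_th S) (noise_th S) (out_th S)"
    and "lipschitz_model L (dom_x S) (par_ph S) (noise_ph S) (out_ph S)"
    and "R\<^sub>\<theta>-lipschitz_on (dom_xy S) (reward_th S)"
    and "R\<^sub>\<phi>-lipschitz_on (dom_xy S) (reward_ph S)"
    and "0 < \<tau>" and "\<tau> < 1"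
  shows "\<exists>C\<^sub>p C\<^sub>q. \<forall>a\<in>{0..1}. \<forall>b\<in>{0..1}.
    (\<forall>w. mix_weights w \<longrightarrow> \<tau> < w_real w \<longrightarrow>
       sensitive S \<epsilon>\<^sub>\<theta> (next_P S a w) \<and> sensitive S \<epsilon>\<^sub>\<phi> (next_Q S b w)) \<longrightarrow>
    convergence_threshold S a b sched \<tau> \<longrightarrow>
    (\<forall>w\<^sub>\<theta> w\<^sub>\<phi>. mix_weights w\<^sub>\<theta> \<longrightarrow> mix_weights w\<^sub>\<phi> \<longrightarrow> \<tau> < w_real w\<^sub>\<theta> \<longrightarrow> \<tau> < w_real w\<^sub>\<phi> \<longrightarrow>
       \<bar>J_p S (theta_star S a b w\<^sub>\<theta> w\<^sub>\<phi>) - J_p S (theta_star S a b purely_real purely_real)\<bar>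
         \<le> C\<^sub>p * (1 - w_real w\<^sub>\<theta>) \<and>
       \<bar>J_q S (phi_star S a b w\<^sub>\<theta> w\<^sub>\<phi>) - J_q S (phi_star S a b purely_real purely_real)\<bar>
         \<le> C\<^sub>q * (1 - w_real w\<^sub>\<phi>))"
proof -
  note wf = assms(1)
  \<comment> \<open>These constants involve only the losses and the data domain. They are fixed
    before the mixing fractions and weights, which gives the uniformity expressed by the order of
    quantifiers.\<close>
  define K\<^sub>\<theta> where "K\<^sub>\<theta> = 4 * \<bar>L\<^sub>\<theta>\<bar> * diameter (dom_xy S) / \<gamma>\<^sub>\<theta>"
  define K\<^sub>\<phi> where "K\<^sub>\<phi> = 4 * \<bar>L\<^sub>\<phi>\<bar> * diameter (dom_xy S) / \<gamma>\<^sub>\<phi>"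
  have bdd: "bounded (dom_xy S)"
    using assms(8,9) by (simp add: dom_xy_def bounded_Times)
  have conv: "convex (par_th S)" "convex (par_ph S)"
    and int: "\<And>\<mu> u. dist_on (dom_xy S) \<mu> \<Longrightarrow> u \<in> par_th S \<Longrightarrow> integrable \<mu> (loss_th S u)"
      "\<And>\<mu> u. dist_on (dom_xy S) \<mu> \<Longrightarrow> u \<in> par_ph S \<Longrightarrow> integrable \<mu> (loss_ph S u)"
    and real: "dist_on (dom_xy S) (real_th S)" "dist_on (dom_xy S) (real_ph S)"
    using wf by (auto simp: well_formed_def)
  have R: "0 \<le> R\<^sub>\<theta> * \<bar>L\<bar>" "0 \<le> R\<^sub>\<phi> * \<bar>L\<bar>"
    using assms(12,13)[THEN lipschitz_on_nonneg] by auto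
  have main: "\<bar>J_p S (theta_star S a b w\<^sub>\<theta> w\<^sub>\<phi>) - J_p S (theta_star S a b purely_real purely_real)\<bar>
        \<le> R\<^sub>\<theta> * \<bar>L\<bar> * K\<^sub>\<theta> * (1 - w_real w\<^sub>\<theta>) \<and>
      \<bar>J_q S (phi_star S a b w\<^sub>\<theta> w\<^sub>\<phi>) - J_q S (phi_star S a b purely_real purely_real)\<bar>
        \<le> R\<^sub>\<phi> * \<bar>L\<bar> * K\<^sub>\<phi> * (1 - w_real w\<^sub>\<phi>)"
    if thr: "convergence_threshold S a b sched \<tau>" and mix: "mix_weights w\<^sub>\<theta>" "mix_weights w\<^sub>\<phi>"
      and \<tau>: "\<tau> < w_real w\<^sub>\<theta>" "\<tau> < w_real w\<^sub>\<phi>" for a b w\<^sub>\<theta> w\<^sub>\<phi>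
  proof -
    let ?s = "the_stable_point S a b w\<^sub>\<theta> w\<^sub>\<phi>" and ?t = "the_stable_point S a b purely_real purely_real"
    have stable: "stable_point S a b v\<^sub>\<theta> v\<^sub>\<phi> (the_stable_point S a b v\<^sub>\<theta> v\<^sub>\<phi>)"
      if "mix_weights v\<^sub>\<theta>" "mix_weights v\<^sub>\<phi>" "\<tau> < w_real v\<^sub>\<theta>" "\<tau> < w_real v\<^sub>\<phi>" for v\<^sub>\<theta> v\<^sub>\<phi>
    proof -
      \<comment> \<open>Unique existence is what makes the \<open>THE\<close> in
        \<open>the_stable_point\<close> denote an actual stable point.\<close>
      have "\<exists>!s. stable_point S a b v\<^sub>\<theta> v\<^sub>\<phi> s"
        using thr that unfolding convergence_threshold_def by simp
      then show ?thesis unfolding the_stable_point_def by (rule theI')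
    qed
    obtain P Q where PQ: "dist_on (dom_xy S) P" "dist_on (dom_xy S) Q"
      "scale_measure (ennreal (w_real w\<^sub>\<theta>)) (real_th S) \<le> P"
      "scale_measure (ennreal (w_real w\<^sub>\<phi>)) (real_ph S) \<le> Q"
      and s: "risk_minimizer (loss_th S) (par_th S) P (fst ?s)"
      "risk_minimizer (loss_ph S) (par_ph S) Q (snd ?s)"
      by (rule stable_point_dominates[OF wf stable[OF mix \<tau>]])
    have "stable_point S a b purely_real purely_real ?t"
      \<comment> \<open>The bound on \<tau> places the purely real weights above the threshold, so
        the reference point exists too.\<close>
      using \<open>\<tau> < 1\<close> by (intro stable) (simp_all add: purely_real_def mix_weights_def)
    note t = stable_point_purely_real[OF wf this]
    have mem: "fst ?s \<in> par_th S" "fst ?t \<in> par_th S" "snd ?s \<in> par_ph S" "snd ?t \<in> par_ph S"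
      using s t by (auto simp: risk_minimizer_def is_arg_min_def)
    have w: "0 \<le> w_real w\<^sub>\<theta>" "w_real w\<^sub>\<theta> \<le> 1" "0 \<le> w_real w\<^sub>\<phi>" "w_real w\<^sub>\<phi> \<le> 1"
      using mix by (auto simp: mix_weights_def)
    have "norm (fst ?s - fst ?t) \<le> K\<^sub>\<theta> * (1 - w_real w\<^sub>\<theta>)"
      unfolding K\<^sub>\<theta>_def
      by (rule risk_minimizer_dist_le[OF assms(2,4,6) conv(1) bdd int(1) PQ(1) real(1) PQ(3) w(1,2) s(1) t(1)])
    from mult_left_mono[OF this R(1)] J_p_lipschitz[OF wf bdd assms(10,12) mem(1,2)]
    have "\<bar>J_p S (fst ?s) - J_p S (fst ?t)\<bar> \<le> R\<^sub>\<theta> * \<bar>L\<bar> * K\<^sub>\<theta> * (1 - w_real w\<^sub>\<theta>)"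
      by (simp add: mult.assoc)
    moreover have "norm (snd ?s - snd ?t) \<le> K\<^sub>\<phi> * (1 - w_real w\<^sub>\<phi>)"
      unfolding K\<^sub>\<phi>_def
      by (rule risk_minimizer_dist_le[OF assms(3,5,7) conv(2) bdd int(2) PQ(2) real(2) PQ(4) w(3,4) s(2) t(2)])
    from mult_left_mono[OF this R(2)] J_q_lipschitz[OF wf bdd assms(11,13) mem(3,4)]
    have "\<bar>J_q S (snd ?s) - J_q S (snd ?t)\<bar> \<le> R\<^sub>\<phi> * \<bar>L\<bar> * K\<^sub>\<phi> * (1 - w_real w\<^sub>\<phi>)"
      by (simp add: mult.assoc)
    ultimately show ?thesis by blast
  qed
  show ?thesis
    by (rule exI[of _ "R\<^sub>\<theta> * \<bar>L\<bar> * K\<^sub>\<theta>"], rule exI[of _ "R\<^sub>\<phi> * \<bar>L\<bar> * K\<^sub>\<phi>"])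
      (intro ballI allI impI main)
qed

end
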